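(* Let $\{f_\theta:\theta\in\Theta\}$ be a single statistical model for the data $x$, let $\pi_1,\ldots,\pi_k$ be prior densities on $\Theta$, let $\alpha\in S_k$ and $t\in[-\infty,\infty]$. Then the relative belief ratio for $\theta$ based on the power mean prior $\pi_{t,\alpha}$ equals $$RB_{t,\alpha}(\theta\,|\,x)=\frac{m_{1,\alpha}(x)}{m_{t,\alpha}(x)}\sum_{i=1}^k\left(\frac{\alpha_i m_i(x)}{\sum_{j=1}^k\alpha_j m_j(x)}\right)RB_i(\theta\,|\,x)=\frac{m_{1,\alpha}(x)}{m_{t,\alpha}(x)}\,RB_{1,\alpha}(\theta\,|\,x).$$
   Context: $S_k=\{\alpha\in[0,1]^k:\sum_i\alpha_i=1\}$. Densities on $\Theta$ are with respect to a fixed support measure $d\theta$. The power mean prior $\pi_{t,\alpha}$ is the probability density proportional to $\{\sum_i\alpha_i\pi_i^t\}^{1/t}$ if $t\neq0,\pm\infty$, to $\exp\{\sum_i\alpha_i\log\pi_i\}$ if $t=0$, to $\min\{\pi_1,\ldots,\pi_k\}$ if $t=-\infty$, and to $\max\{\pi_1,\ldots,\pi_k\}$ if $t=\infty$; it is assumed that the relevant function has integral in $(0,\infty)$. In particular $\pi_{1,\alpha}=\sum_i\alpha_i\pi_i$ (linear pooling). $m_i(x)=\int_\Theta f_\theta(x)\pi_i(\theta)\,d\theta$ and $m_{t,\alpha}(x)=\int_\Theta f_\theta(x)\pi_{t,\alpha}(\theta)\,d\theta$ are the prior predictive densities, assumed positive and finite at the observed $x$. The relative belief ratio of $\theta$ based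 on a prior $\pi$ is the ratio of posterior to prior density, $RB(\theta\,|\,x)=\pi(\theta\,|\,x)/\pi(\theta)$ with $\pi(\theta\,|\,x)=f_\theta(x)\pi(\theta)/m(x)$ and $m(x)=\int_\Theta f_\theta(x)\pi(\theta)\,d\theta$; at points with $\pi(\theta)=0$ it is taken to be $f_\theta(x)/m(x)$, the value the ratio has wherever $\pi(\theta)>0$. $RB_i$ and $RB_{t,\alpha}$ denote the relative belief ratios based on $\pi_i$ and $\pi_{t,\alpha}$, respectively. *)

theory Defs
  imports "HOL-Analysis.Analysis"
begin

definition weight_simplex :: "nat \<Rightarrow> (nat \<Rightarrow> real) set" where
  "weight_simplex k = {\<alpha>. (\<forall>i\<in>{1..k}. 0 \<le> \<alpha> i \<and> \<alpha> i \<le> 1) \<and> (\<Sum>i=1..k. \<alpha> i) = 1}"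

definition is_prob_density :: "'a measure \<Rightarrow> ('a \<Rightarrow> real) \<Rightarrow> bool" where
  "is_prob_density M p \<longleftrightarrow>
     (\<forall>\<theta>\<in>space M. 0 \<le> p \<theta>) \<and> integrable M p \<and> (\<integral>\<theta>. p \<theta> \<partial>M) = 1"

text \<open>
  The parameter space is \<open>space M\<close> with support measure \<open>M\<close>; the sample space is
  \<open>space N\<close>, and every \<open>f \<theta>\<close> is a density with respect to \<open>N\<close>.
\<close>
definition statistical_model ::
    "'a measure \<Rightarrow> 'b measure \<Rightarrow> ('a \<Rightarrow> 'b \<Rightarrow> real) \<Rightarrow> bool" where
  "statistical_model M N f \<longleftrightarrow>
     (\<forall>\<theta>\<in>space M. is_prob_density N (f \<theta>)) \<and>
     (\<forall>x\<in>space N. (\<lambda>\<theta>. f \<theta> x) \<in> borel_measurable M)"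

text \<open>
  Prior densities may vanish, and on the reals \<open>ln 0 = 0\<close> and \<open>0 powr t = 0\<close> even for
  \<open>t < 0\<close>. The logarithm and the powers occurring in a power mean are therefore taken in the
  extended reals: \<open>log 0 = -\<infinity>\<close>, and for \<open>t < 0\<close>, \<open>0\<^sup>t = \<infinity>\<close> and \<open>\<infinity>\<^sup>t = 0\<close>.
  Since \<open>0 * \<infinity> = 0\<close> in \<^typ>\<open>ereal\<close>, a term of weight \<open>0\<close> does not contribute to a
  weighted sum. Both functions are meant for nonnegative arguments, and
  \<open>powr_ereal\<close> for a nonzero exponent.
\<close>
definition ln_ereal :: "ereal \<Rightarrow> ereal" where
  "ln_ereal x = (if x \<le> 0 then -\<infinity> else if x = \<infinity> then \<infinity> else ereal (ln (real_of_ereal x)))"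

definition exp_ereal :: "ereal \<Rightarrow> ereal" where
  "exp_ereal x =
     (if x = -\<infinity> then 0 else if x = \<infinity> then \<infinity> else ereal (exp (real_of_ereal x)))"

definition powr_ereal :: "ereal \<Rightarrow> real \<Rightarrow> ereal" where
  "powr_ereal x t =
     (if x \<le> 0 then (if t < 0 then \<infinity> else 0)
      else if x = \<infinity> then (if t < 0 then 0 else \<infinity>)
      else ereal (real_of_ereal x powr t))"

definition power_mean ::
    "ereal \<Rightarrow> nat \<Rightarrow> (nat \<Rightarrow> real) \<Rightarrow> (nat \<Rightarrow> 'a \<Rightarrow> real) \<Rightarrow> 'a \<Rightarrow> real" where
  "power_mean t k \<alpha> \<pi> \<theta> =
     (if t = \<infinity> then Max ((\<lambda>i. \<pi> i \<theta>) ` {1..k})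
      else if t = -\<infinity> then Min ((\<lambda>i. \<pi> i \<theta>) ` {1..k})
      else if t = 0 then
        real_of_ereal (exp_ereal (\<Sum>i=1..k. ereal (\<alpha> i) * ln_ereal (ereal (\<pi> i \<theta>))))
      else
        real_of_ereal (powr_ereal
          (\<Sum>i=1..k. ereal (\<alpha> i) * powr_ereal (ereal (\<pi> i \<theta>)) (real_of_ereal t))
          (1 / real_of_ereal t)))"

text \<open>Where the priors are positive, the extended-real operations are the ordinary ones.\<close>
lemma power_mean_positive:
  assumes "\<And>i. i \<in> {1..k} \<Longrightarrow> 0 < \<pi> i \<theta>" and "\<alpha> \<in> weight_simplex k" and "r \<noteq> 0"
  shows "power_mean (ereal r) k \<alpha> \<pi> \<theta> = (\<Sum>i=1..k. \<alpha> i * \<pi> i \<theta> powr r) powr (1/r)"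
    and "power_mean 0 k \<alpha> \<pi> \<theta> = exp (\<Sum>i=1..k. \<alpha> i * ln (\<pi> i \<theta>))"
proof -
  have e: "powr_ereal (ereal y) t = ereal (y powr t)" if "0 < y" for y t using that by (auto simp: powr_ereal_def zero_ereal_def)
  have l: "ln_ereal (ereal y) = ereal (ln y)" if "0 < y" for y using that by (auto simp: ln_ereal_def zero_ereal_def)
  have "(\<Sum>i=1..k. ereal (\<alpha> i) * powr_ereal (ereal (\<pi> i \<theta>)) r) = (\<Sum>i=1..k. ereal (\<alpha> i * \<pi> i \<theta> powr r))"
    by (rule sum.cong) (auto simp: e assms)
  moreover have "0 < (\<Sum>i=1..k. \<alpha> i * \<pi> i \<theta> powr r)"
  proof -
    obtain i where "i\<in>{1..k}" "\<alpha> i \<noteq> 0" using assms(2) unfolding weight_simplex_def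
      by (metis (mono_tags, lifting) mem_Collect_eq sum.neutral zero_neq_one)
    then show ?thesis using assms
      by (intro sum_pos2[where i=i]) (auto simp: weight_simplex_def less_le intro!: mult_pos_pos)
  qed
  ultimately show "power_mean (ereal r) k \<alpha> \<pi> \<theta> = (\<Sum>i=1..k. \<alpha> i * \<pi> i \<theta> powr r) powr (1/r)"
    by (simp add: power_mean_def e assms zero_ereal_def)
  have "(\<Sum>i=1..k. ereal (\<alpha> i) * ln_ereal (ereal (\<pi> i \<theta>))) = (\<Sum>i=1..k. ereal (\<alpha> i * ln (\<pi> i \<theta>)))"
    by (rule sum.cong) (auto simp: l assms)
  then show "power_mean 0 k \<alpha> \<pi> \<theta> = exp (\<Sum>i=1..k. \<alpha> i * ln (\<pi> i \<theta>))"
    by (simp add: power_mean_def exp_ereal_def)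
qed

definition power_mean_prior ::
    "'a measure \<Rightarrow> ereal \<Rightarrow> nat \<Rightarrow> (nat \<Rightarrow> real) \<Rightarrow> (nat \<Rightarrow> 'a \<Rightarrow> real) \<Rightarrow> 'a \<Rightarrow> real" where
  "power_mean_prior M t k \<alpha> \<pi> \<theta> =
     power_mean t k \<alpha> \<pi> \<theta> / (\<integral>\<theta>'. power_mean t k \<alpha> \<pi> \<theta>' \<partial>M)"

definition prior_predictive ::
    "'a measure \<Rightarrow> ('a \<Rightarrow> 'b \<Rightarrow> real) \<Rightarrow> ('a \<Rightarrow> real) \<Rightarrow> 'b \<Rightarrow> real" where
  "prior_predictive M f p x = (\<integral>\<theta>. f \<theta> x * p \<theta> \<partial>M)"

definition posterior_density ::
    "'a measure \<Rightarrow> ('a \<Rightarrow> 'b \<Rightarrow> real) \<Rightarrow> ('a \<Rightarrow> real) \<Rightarrow> 'b \<Rightarrow> 'a \<Rightarrow> real" where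
  "posterior_density M f p x \<theta> = f \<theta> x * p \<theta> / prior_predictive M f p x"

text \<open>Where the prior vanishes the ratio \<open>0 / 0\<close> is replaced by the value it has elsewhere.\<close>
definition relative_belief ::
    "'a measure \<Rightarrow> ('a \<Rightarrow> 'b \<Rightarrow> real) \<Rightarrow> ('a \<Rightarrow> real) \<Rightarrow> 'b \<Rightarrow> 'a \<Rightarrow> real" where
  "relative_belief M f p x \<theta> =
     (if p \<theta> = 0 then f \<theta> x / prior_predictive M f p x
      else posterior_density M f p x \<theta> / p \<theta>)"

end

theory Submission
  imports Defs
begin

text \<open>
  Wherever the prior density is positive it cancels from posterior over prior, so the relative
  belief ratio of any prior \<open>p\<close> is \<open>f \<theta> x / m\<^sub>p x\<close>: as a function of \<open>\<theta>\<close> it is the likelihood, and the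
  prior enters only through the normalizing constant (\<open>relative_belief_eq\<close>). Relative
  belief ratios for the same model are therefore inversely proportional to the prior predictive
  densities, which gives the comparison of \<open>t\<close> with \<open>1\<close>.

  The mixture form rests on the linearity of the prior predictive density in the prior. The power
  mean of order \<open>1\<close> is the mixture of the priors, which already has integral \<open>1\<close>, so its prior
  predictive density is the mixture of the \<open>m\<^sub>i x\<close> with the same weights
  (\<open>prior_predictive_linear_pool\<close>). Multiplying \<open>f \<theta> x / m\<^sub>i x\<close> by the posterior weight
  \<open>\<alpha>\<^sub>i m\<^sub>i x / (\<Sum>j. \<alpha>\<^sub>j m\<^sub>j x)\<close> cancels \<open>m\<^sub>i x\<close>, and the remaining \<open>\<alpha>\<^sub>i\<close> add up to \<open>1\<close>.
\<close>

text \<open>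
  The prior cancels from posterior over prior, and the convention at zeros of the prior extends
  the resulting formula to every parameter.
\<close>
lemma relative_belief_eq:
  "relative_belief M f p x \<theta> = f \<theta> x / prior_predictive M f p x"
  by (simp add: relative_belief_def posterior_density_def)

text \<open>
  The extended-real power of exponent \<open>1\<close> is the identity on nonnegative numbers only: it sends
  negative ones to \<open>0\<close>.
\<close>
lemma power_mean_one:
  assumes "\<And>i. i \<in> {1..k} \<Longrightarrow> 0 \<le> \<pi> i \<theta>" and "\<alpha> \<in> weight_simplex k"
  shows "power_mean 1 k \<alpha> \<pi> \<theta> = (\<Sum>i=1..k. \<alpha> i * \<pi> i \<theta>)"
proof -
  have powr_one: "powr_ereal (ereal y) 1 = ereal y" if "0 \<le> y" for y
    using that by (auto simp: powr_ereal_def zero_ereal_def)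
  have "(\<Sum>i=1..k. ereal (\<alpha> i) * powr_ereal (ereal (\<pi> i \<theta>)) 1) = ereal (\<Sum>i=1..k. \<alpha> i * \<pi> i \<theta>)"
    by (simp add: powr_one assms(1))
  moreover have "0 \<le> (\<Sum>i=1..k. \<alpha> i * \<pi> i \<theta>)"
    using assms by (intro sum_nonneg mult_nonneg_nonneg) (auto simp: weight_simplex_def)
  ultimately show ?thesis
    by (simp add: power_mean_def powr_one)
qed

text \<open>A mixture of probability densities needs no normalization.\<close>
lemma power_mean_prior_one:
  assumes "\<And>i. i \<in> {1..k} \<Longrightarrow> is_prob_density M (\<pi> i)" and "\<alpha> \<in> weight_simplex k"
    and "\<theta> \<in> space M"
  shows "power_mean_prior M 1 k \<alpha> \<pi> \<theta> = (\<Sum>i=1..k. \<alpha> i * \<pi> i \<theta>)"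
proof -
  have pool: "power_mean 1 k \<alpha> \<pi> \<eta> = (\<Sum>i=1..k. \<alpha> i * \<pi> i \<eta>)" if "\<eta> \<in> space M" for \<eta>
    using assms that by (intro power_mean_one) (auto simp: is_prob_density_def)
  have "(\<integral>\<eta>. power_mean 1 k \<alpha> \<pi> \<eta> \<partial>M) = (\<integral>\<eta>. (\<Sum>i=1..k. \<alpha> i * \<pi> i \<eta>) \<partial>M)"
    by (intro Bochner_Integration.integral_cong refl pool)
  also have "\<dots> = (\<Sum>i=1..k. \<alpha> i * (\<integral>\<eta>. \<pi> i \<eta> \<partial>M))"
    using assms(1) by (subst Bochner_Integration.integral_sum) (auto simp: is_prob_density_def)
  also have "\<dots> = 1"
    using assms(1,2) by (simp add: is_prob_density_def weight_simplex_def)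
  finally show ?thesis
    using pool[OF assms(3)] by (simp add: power_mean_prior_def)
qed

lemma prior_predictive_linear_pool:
  assumes "\<And>i. i \<in> {1..k} \<Longrightarrow> is_prob_density M (\<pi> i)" and "\<alpha> \<in> weight_simplex k"
    and "\<And>i. i \<in> {1..k} \<Longrightarrow> integrable M (\<lambda>\<theta>. f \<theta> x * \<pi> i \<theta>)"
  shows "prior_predictive M f (power_mean_prior M 1 k \<alpha> \<pi>) x
    = (\<Sum>i=1..k. \<alpha> i * prior_predictive M f (\<pi> i) x)"
proof -
  have pool: "power_mean_prior M 1 k \<alpha> \<pi> \<theta> = (\<Sum>i=1..k. \<alpha> i * \<pi> i \<theta>)" if "\<theta> \<in> space M" for \<theta>
    using assms(1,2) that by (rule power_mean_prior_one)
  have "prior_predictive M f (power_mean_prior M 1 k \<alpha> \<pi>) x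
      = (\<integral>\<theta>. (\<Sum>i=1..k. \<alpha> i * (f \<theta> x * \<pi> i \<theta>)) \<partial>M)"
    unfolding prior_predictive_def
    by (intro Bochner_Integration.integral_cong refl)
      (simp add: pool sum_distrib_left mult.left_commute)
  also have "\<dots> = (\<Sum>i=1..k. \<alpha> i * prior_predictive M f (\<pi> i) x)"
    unfolding prior_predictive_def using assms(3)
    by (subst Bochner_Integration.integral_sum) auto
  finally show ?thesis .
qed

text \<open>
  Individual weights may vanish, but they sum to \<open>1\<close>, so one of them is positive.
\<close>
lemma weighted_sum_pos:
  assumes "\<alpha> \<in> weight_simplex k" and "\<And>i. i \<in> {1..k} \<Longrightarrow> 0 < m i"
  shows "0 < (\<Sum>i=1..k. \<alpha> i * m i)"
proof -
  obtain i where "i \<in> {1..k}" "\<alpha> i \<noteq> 0"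
    using assms(1) unfolding weight_simplex_def
    by (metis (mono_tags, lifting) mem_Collect_eq sum.neutral zero_neq_one)
  then show ?thesis
    using assms
    by (intro sum_pos2[where i=i]) (auto simp: weight_simplex_def less_le intro!: mult_pos_pos)
qed

theorem proposition3:
  fixes M :: "'a measure" and N :: "'b measure"
    and f :: "'a \<Rightarrow> 'b \<Rightarrow> real" and x :: 'b
    and k :: nat and \<pi> :: "nat \<Rightarrow> 'a \<Rightarrow> real" and \<alpha> :: "nat \<Rightarrow> real"
    and t :: ereal and \<theta> :: 'a
  assumes model: "statistical_model M N f" and x: "x \<in> space N"
    and prior: "\<And>i. i \<in> {1..k} \<Longrightarrow> is_prob_density M (\<pi> i)"
    and \<alpha>: "\<alpha> \<in> weight_simplex k"
    and mean_integrable: "integrable M (power_mean t k \<alpha> \<pi>)"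
    and mean_pos: "0 < (\<integral>\<theta>. power_mean t k \<alpha> \<pi> \<theta> \<partial>M)"
    and m_integrable: "\<And>i. i \<in> {1..k} \<Longrightarrow> integrable M (\<lambda>\<theta>. f \<theta> x * \<pi> i \<theta>)"
    and m_pos: "\<And>i. i \<in> {1..k} \<Longrightarrow> 0 < prior_predictive M f (\<pi> i) x"
    and mt_integrable: "integrable M (\<lambda>\<theta>. f \<theta> x * power_mean_prior M t k \<alpha> \<pi> \<theta>)"
    and mt_pos: "0 < prior_predictive M f (power_mean_prior M t k \<alpha> \<pi>) x"
    and \<theta>: "\<theta> \<in> space M"
  shows "let m = (\<lambda>i. prior_predictive M f (\<pi> i) x);
             RB = (\<lambda>i. relative_belief M f (\<pi> i) x \<theta>);
             pm = (\<lambda>s. power_mean_prior M s k \<alpha> \<pi>);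
             mpm = (\<lambda>s. prior_predictive M f (pm s) x);
             RBpm = (\<lambda>s. relative_belief M f (pm s) x \<theta>)
         in RBpm t =
              mpm 1 / mpm t * (\<Sum>i=1..k. (\<alpha> i * m i / (\<Sum>j=1..k. \<alpha> j * m j)) * RB i) \<and>
            mpm 1 / mpm t * (\<Sum>i=1..k. (\<alpha> i * m i / (\<Sum>j=1..k. \<alpha> j * m j)) * RB i) =
              mpm 1 / mpm t * RBpm 1"
proof -
  define m where "m = (\<lambda>i. prior_predictive M f (\<pi> i) x)"
  define S where "S = (\<Sum>j=1..k. \<alpha> j * m j)"
  have S_pos: "0 < S"
    unfolding S_def using \<alpha> m_pos by (intro weighted_sum_pos) (auto simp: m_def)
  have m1: "prior_predictive M f (power_mean_prior M 1 k \<alpha> \<pi>) x = S"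
    unfolding S_def m_def using prior \<alpha> m_integrable by (rule prior_predictive_linear_pool)
  have "(\<Sum>i=1..k. (\<alpha> i * m i / S) * (f \<theta> x / m i)) = (\<Sum>i=1..k. \<alpha> i * (f \<theta> x / S))"
    using m_pos by (intro sum.cong) (force simp: m_def)+
  also have "\<dots> = f \<theta> x / S"
    unfolding sum_distrib_right[symmetric] using \<alpha> by (simp add: weight_simplex_def)
  finally have mixture: "(\<Sum>i=1..k. (\<alpha> i * m i / S) * (f \<theta> x / m i)) = f \<theta> x / S" .
  show ?thesis
    unfolding Let_def relative_belief_eq m1
    unfolding m_def[THEN fun_cong, symmetric] S_def[symmetric] mixture
    using S_pos by simp
qed

end
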